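(* Let $L$ be a planar pentagonal linkage with sidelengths $a_1,a_2,a_3,a_4,a_5>0$. Let $\tilde I_5(u)$ be the modified Sylvester polynomial and $H_5(u)$ the Robbins polynomial associated with $(a_1,\dots,a_5)$, as defined in the context. A necessary condition for the existence of a bicentric configuration of $L$ (convex or not) is that $$\operatorname{Res}_u(\tilde I_5,H_5)=0,$$ where $\operatorname{Res}_u$ denotes the resultant of the two polynomials in the variable $u$.
   Context: A planar pentagon is a polygon $V_1V_2V_3V_4V_5$ in the Euclidean plane (indices mod 5); convexity is not assumed, so for example a 5-pointed star is allowed. The planar pentagonal linkage $L$ with sidelengths $a_1,\dots,a_5>0$ is the collection of all planar pentagons with fixed side lengths $|V_jV_{j+1}|=a_j$, $j=1,\dots,5$, and changeable angles; such pentagons are the configurations of $L$. A planar polygon is chordal (cyclic) if all its vertices lie on one circle. It is tangential if there is a circle tangent to each side of the polygon at an inner point of that side. It is bicentric if it is both chordal and tangential. Let $(x_1,\dots,x_5)$ be the unique solution of the linear system $x_j+x_{j+1}=a_j$, $j=1,\dots,5$ (indices mod 5); these are the tangent lengths. Let $s_k$ be the $k$-th elementary symmetric function of $x_1,\dots,x_5$, and let $p=\frac12(a_1+\dots+a_5)$ be the semiperimeter. The modified Sylvester polynomial $\tilde I_5(u)$ is obtained from $s_1z^4-p^2s_3z^2+p^4s_5$ by passing from $z$ to the variable $u=16z^2$. Up to a nonzero constant factor, $$\tilde I_5(u)=s_1u^2-16p^2s_3u+256p^4s_5.$$ Let $e_k$ be the $k$-th elementary symmetric function of $a_1^2,\dots,a_5^2$.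 Put $$t_2=e_1^2+u-4e_2,\quad t_3=e_1t_2+8e_3,\quad t_4=t_2^2-64e_4,\quad t_5=128e_5.$$ The Robbins polynomial is $$H_5(u)=u\,t_4^3+t_3^2t_4^2-16\,t_3^3t_5-18\,u\,t_3t_4t_5-27\,u^2t_5^2,$$ regarded as a polynomial in $u$ (of degree 7).
   Formalization: The five vertices are required to be pairwise distinct, excluding sides folded back onto a neighbour; otherwise a 3-4-5 triangle ABC traversed as ABABC, with sidelengths (3,3,3,5,4), is chordal and tangential but has nonzero resultant. *)

theory Defs
  imports "HOL-Analysis.Analysis" "Subresultants.Resultant_Prelim"
begin

text \<open>
  Indices live in the numeral type \<^typ>\<open>5\<close>, whose arithmetic is arithmetic modulo 5; the
  index 5 is its element 0, so \<^term>\<open>j + 1\<close> is the cyclic successor of \<^term>\<open>j\<close>.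
\<close>

text \<open>
  A pentagon has five distinct vertices; apart from that it may be non-convex and self-crossing.
  Since sides have positive length, distinctness only excludes \<open>V j = V (j + 2)\<close>, i.e. a side
  folded back onto its neighbour.  This cannot be dropped: a triangle \<open>ABC\<close> with side lengths
  \<open>|AB| = 3\<close>, \<open>|BC| = 5\<close>, \<open>|CA| = 4\<close>, traversed as \<open>A B A B C\<close>, has its vertices on
  the circumcircle and its sides tangent to the incircle, but the resultant of the two polynomials
  below for the side lengths 3, 3, 3, 5, 4 is not zero.
\<close>

definition pentagon :: "(5 \<Rightarrow> real ^ 2) \<Rightarrow> bool" where
  "pentagon V \<longleftrightarrow> inj V"

definition linkage_configurations :: "(5 \<Rightarrow> real) \<Rightarrow> (5 \<Rightarrow> real ^ 2) set" where
  "linkage_configurations a = {V. pentagon V \<and> (\<forall>j. dist (V j) (V (j + 1)) = a j)}"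

definition chordal :: "(5 \<Rightarrow> real ^ 2) \<Rightarrow> bool" where
  "chordal V \<longleftrightarrow> (\<exists>c r. r > 0 \<and> (\<forall>j. V j \<in> sphere c r))"

text \<open>A line is tangent to a circle at \<open>T\<close> if \<open>T\<close> is their only common point.\<close>

definition tangent_at_inner_point :: "real ^ 2 \<Rightarrow> real \<Rightarrow> real ^ 2 \<Rightarrow> real ^ 2 \<Rightarrow> bool" where
  "tangent_at_inner_point c r A B \<longleftrightarrow>
     (\<exists>T \<in> open_segment A B. affine hull {A, B} \<inter> sphere c r = {T})"

definition tangential :: "(5 \<Rightarrow> real ^ 2) \<Rightarrow> bool" where
  "tangential V \<longleftrightarrow>
     (\<exists>c r. r > 0 \<and> (\<forall>j. tangent_at_inner_point c r (V j) (V (j + 1))))"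

definition bicentric :: "(5 \<Rightarrow> real ^ 2) \<Rightarrow> bool" where
  "bicentric V \<longleftrightarrow> chordal V \<and> tangential V"

definition elem_sym :: "nat \<Rightarrow> ('i::finite \<Rightarrow> real) \<Rightarrow> real" where
  "elem_sym k f = (\<Sum>K | card K = k. \<Prod>j\<in>K. f j)"

definition tangent_lengths :: "(5 \<Rightarrow> real) \<Rightarrow> 5 \<Rightarrow> real" where
  "tangent_lengths a = (THE x. \<forall>j. x j + x (j + 1) = a j)"

lemma tangent_lengths_unique_solution:
  fixes a :: "5 \<Rightarrow> real"
  shows "\<exists>!x. \<forall>j. x j + x (j + 1) = a j"
proof (rule ex1I)
  have five: "(5 :: 5) = 0"
    by simp
  show "\<forall>j. (a j - a (j + 1) + a (j + 2) - a (j + 3) + a (j + 4)) / 2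
      + (a (j + 1) - a (j + 1 + 1) + a (j + 1 + 2) - a (j + 1 + 3) + a (j + 1 + 4)) / 2 = a j"
    by (simp add: five add.assoc field_simps)
  fix x :: "5 \<Rightarrow> real"
  assume x: "\<forall>j. x j + x (j + 1) = a j"
  show "x = (\<lambda>j. (a j - a (j + 1) + a (j + 2) - a (j + 3) + a (j + 4)) / 2)"
  proof
    fix j :: 5
    have "x (j + 4) + x j = a (j + 4)"
      using x[rule_format, of "j + 4"] by (simp add: five add.assoc)
    then show "x j = (a j - a (j + 1) + a (j + 2) - a (j + 3) + a (j + 4)) / 2"
      using x[rule_format, of j] x[rule_format, of "j + 1"]
        x[rule_format, of "j + 2"] x[rule_format, of "j + 3"]
      by (simp add: add.assoc)
  qed
qed

definition semiperimeter :: "(5 \<Rightarrow> real) \<Rightarrow> real" where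
  "semiperimeter a = (\<Sum>j\<in>UNIV. a j) / 2"

text \<open>
  256 times \<open>s\<^sub>1 z^4 - p^2 s\<^sub>3 z^2 + p^4 s\<^sub>5\<close>, as a polynomial in \<open>u = 16 z^2\<close>.
\<close>

definition modified_sylvester_poly :: "(5 \<Rightarrow> real) \<Rightarrow> real poly" where
  "modified_sylvester_poly a =
     (let x = tangent_lengths a; p = semiperimeter a
      in [: 256 * p ^ 4 * elem_sym 5 x, - 16 * p ^ 2 * elem_sym 3 x, elem_sym 1 x :])"

definition robbins_poly :: "(5 \<Rightarrow> real) \<Rightarrow> real poly" where
  "robbins_poly a =
     (let e = (\<lambda>k. elem_sym k (\<lambda>j. (a j)\<^sup>2));
          u = [:0, 1:];
          t2 = [: (e 1)\<^sup>2 :] + u - [: 4 * e 2 :];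
          t3 = [: e 1 :] * t2 + [: 8 * e 3 :];
          t4 = t2 ^ 2 - [: 64 * e 4 :];
          t5 = [: 128 * e 5 :]
      in u * t4 ^ 3 + t3 ^ 2 * t4 ^ 2 - 16 * t3 ^ 3 * t5 - 18 * u * t3 * t4 * t5
           - 27 * u ^ 2 * t5 ^ 2)"

end

theory Submission
  imports Defs "Subresultants.Subresultant_Gcd" "HOL-Computational_Algebra.Field_as_Ring"
begin

text \<open>
  The common root is \<open>u = 16 K\<^sup>2\<close>, where \<open>K\<close> is the signed area of the bicentric pentagon.  Seen
  from the incentre, all sides are traversed in the same direction, so \<open>K = \<plusminus> r p\<close> with \<open>r\<close> the
  inradius, and closing up around the incircle says that \<open>\<Prod>\<^sub>j (r + \<i> x\<^sub>j)\<close> is real, i.e.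
  \<open>s\<^sub>1 r^4 - s\<^sub>3 r^2 + s\<^sub>5 = 0\<close>; this makes \<open>u\<close> a root of the Sylvester polynomial.  Seen from the
  circumcentre, the ratios \<open>q\<^sub>j\<close> of consecutive vertices have product 1, and all squared sides as
  well as \<open>K\<close> are expressed through them.  The Robbins polynomial is, up to the factor \<open>4 u\<^sup>2\<close>, the
  discriminant of \<open>z^3 + 2 t\<^sub>3 z^2 - u t\<^sub>4 z + 2 u^2 t\<^sub>5\<close>, which then has a double root.
\<close>

subsection \<open>Elementary symmetric functions and resultants\<close>

text \<open>Recursive on the list, so that with five explicit entries simplification expands it into
  a polynomial.\<close>

fun esym :: "nat \<Rightarrow> 'a::comm_semiring_1 list \<Rightarrow> 'a" where
  "esym 0 xs = 1"
| "esym (Suc k) [] = 0"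
| "esym (Suc k) (x # xs) = esym (Suc k) xs + x * esym k xs"

lemma esym_scale: "esym k (map ((*) c) xs) = c ^ k * esym k xs"
  by (induction k xs rule: esym.induct) (auto simp: algebra_simps)

lemma esym_of_real:
  "esym k (map of_real xs) = (of_real (esym k xs) :: 'a::{real_algebra_1, comm_semiring_1})"
  by (induction k xs rule: esym.induct) auto

text \<open>A \<open>Suc k\<close>-subset of \<open>x # xs\<close> either avoids \<open>x\<close> or
  is a \<open>k\<close>-subset of \<open>xs\<close> with \<open>x\<close> inserted; this is the
  recursion of \<open>esym\<close>.\<close>

lemma sum_subsets_eq_esym:
  fixes f :: "'b \<Rightarrow> 'a::comm_semiring_1"
  assumes "distinct xs"
  shows "(\<Sum>K | K \<subseteq> set xs \<and> card K = k. prod f K) = esym k (map f xs)"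
  using assms
proof (induction xs arbitrary: k)
  case Nil
  have "{K. K \<subseteq> set ([] :: 'b list) \<and> card K = k} = (if k = 0 then {{}} else {})"
    by auto
  then have "(\<Sum>K | K \<subseteq> set [] \<and> card K = k. prod f K) = (if k = 0 then 1 else 0)"
    by (simp only:) simp
  then show ?case by (cases k) simp_all
next
  case (Cons x xs k')
  show ?case
  proof (cases k')
    case 0
    have "{K. K \<subseteq> set (x # xs) \<and> card K = 0} = {{}}"
      by (auto dest: finite_subset)
    then show ?thesis using 0 by (simp only:) simp
  next
    case (Suc k)
    let ?S = "\<lambda>k. {K. K \<subseteq> set xs \<and> card K = k}"
    have x: "x \<notin> K" if "K \<in> ?S k" for K k
      using that Cons.prems by auto
    have split: "{K. K \<subseteq> set (x # xs) \<and> card K = Suc k} = ?S (Suc k) \<union> insert x ` ?S k"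
      (is "?L = ?R")
    proof
      show "?L \<subseteq> ?R"
      proof
        fix K assume K: "K \<in> ?L"
        show "K \<in> ?R"
        proof (cases "x \<in> K")
          case True
          then have "K = insert x (K - {x})" "K - {x} \<in> ?S k"
            using K by auto
          then show ?thesis by blast
        qed (use K in auto)
      qed
      show "?R \<subseteq> ?L"
        using x by (auto simp: card_insert_if finite_subset[OF _ finite_set])
    qed
    have fin: "finite (?S k)" for k
      by (rule finite_subset[of _ "Pow (set xs)"]) auto
    have inj: "inj_on (insert x) (?S k)"
      by (rule inj_onI) (metis insert_ident x)
    have disj: "?S (Suc k) \<inter> insert x ` ?S k = {}"
      using Cons.prems by auto
    have "prod f (insert x K) = f x * prod f K" if "K \<in> ?S k" for K
    proof -
      have "finite K"
        using that finite_subset[of K "set xs"] by simp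
      then show ?thesis
        using x[OF that] by simp
    qed
    then have "(\<Sum>K\<in>?S k. prod f (insert x K)) = f x * esym k (map f xs)"
      using Cons by (simp flip: sum_distrib_left)
    then show ?thesis
      using Cons unfolding Suc split by (simp add: sum.union_disjoint fin disj sum.reindex[OF inj])
  qed
qed

lemma UNIV_5: "(UNIV :: 5 set) = {0, 1, 2, 3, 4}"
proof -
  have "card {0, 1, 2, 3, 4 :: 5} = CARD(5)"
    by simp
  then show ?thesis
    using card_subset_eq[of "UNIV :: 5 set" "{0, 1, 2, 3, 4}"] by simp
qed

lemma elem_sym_5: "elem_sym k f = esym k (map f [0, 1, 2, 3, 4 :: 5])"
proof -
  have *: "distinct [0, 1, 2, 3, 4 :: 5]" by simp
  show ?thesis
    unfolding sum_subsets_eq_esym[OF *, symmetric] elem_sym_def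
    using UNIV_5 by simp
qed

text \<open>The resultant vanishes iff the gcd is non-constant. Here \<open>[:- x, 1:]\<close>
  divides the gcd, which is nonzero because \<open>f\<close> is.\<close>

lemma resultant_eq_0_if_common_root:
  fixes f g :: "'a::field_gcd poly"
  assumes "f \<noteq> 0" "poly f x = 0" "poly g x = 0"
  shows "resultant f g = 0"
proof -
  have "[:- x, 1:] dvd gcd f g"
    using assms by (simp add: poly_eq_0_iff_dvd)
  then show ?thesis
    using assms(1) dvd_imp_degree_le[of "[:- x, 1:]" "gcd f g"]
    unfolding resultant_0_gcd by force
qed

subsection \<open>The Robbins polynomial of a cyclic pentagon\<close>

text \<open>Stated over any commutative ring, with the symmetric functions as free arguments, so
  that complex expressions can be substituted for them.\<close>

definition robbins_form :: "'a \<Rightarrow> 'a \<Rightarrow> 'a \<Rightarrow> 'a \<Rightarrow> 'a \<Rightarrow> 'a \<Rightarrow> 'a::comm_ring_1" where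
  "robbins_form e1 e2 e3 e4 e5 u =
     (let t2 = e1\<^sup>2 + u - 4 * e2; t3 = e1 * t2 + 8 * e3; t4 = t2 ^ 2 - 64 * e4; t5 = 128 * e5
      in u * t4 ^ 3 + t3 ^ 2 * t4 ^ 2 - 16 * t3 ^ 3 * t5 - 18 * u * t3 * t4 * t5
           - 27 * u ^ 2 * t5 ^ 2)"

definition robbins :: "'a list \<Rightarrow> 'a \<Rightarrow> 'a::comm_ring_1" where
  "robbins bs u = robbins_form (esym 1 bs) (esym 2 bs) (esym 3 bs) (esym 4 bs) (esym 5 bs) u"

lemma poly_robbins_poly:
  "poly (robbins_poly a) u = robbins (map (\<lambda>j. (a j)\<^sup>2) [0, 1, 2, 3, 4]) u"
  unfolding robbins_poly_def robbins_form_def Let_def elem_sym_5 robbins_def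
  by (simp only: poly_add poly_diff poly_mult poly_power poly_pCons poly_numeral poly_0) simp

lemma robbins_of_real:
  "robbins (map of_real xs) (of_real u) = complex_of_real (robbins xs u)"
  unfolding robbins_def esym_of_real robbins_form_def Let_def by simp

text \<open>
  The hypotheses say that the cubic with discriminant \<open>4 u\<^sup>2\<close> times the Robbins form has the double
  root \<open>4 d g\<close> and the simple root \<open>16 d\<^sup>2\<close>.
\<close>

lemma robbins_form_eq_0:
  fixes d :: complex
  assumes t3: "e1 * (e1\<^sup>2 + u - 4 * e2) + 8 * e3 = - 4 * d * (g + 2 * d)"
    and t4: "(e1\<^sup>2 + u - 4 * e2)\<^sup>2 - 64 * e4 = 16 * g * (g + 8 * d)"
    and "u = - d\<^sup>2" "e5 = - g\<^sup>2"
  shows "robbins_form e1 e2 e3 e4 e5 u = 0"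
proof -
  \<comment> \<open>Now \<open>t3 = - 4 * d * k\<close> and \<open>t4 = 16 * g * h\<close>, so
    \<open>4096 * d^2 * g^2\<close> splits off the form; the other factor is identically zero in
    \<open>d\<close> and \<open>g\<close>.\<close>
  define h k where "h = g + 8 * d" and "k = g + 2 * d"
  have "k\<^sup>2 * h\<^sup>2 - g * h ^ 3 - 32 * d * k ^ 3 + 36 * d * g * h * k - 108 * d\<^sup>2 * g\<^sup>2 = 0"
    unfolding h_def k_def by (simp add: algebra_simps eval_nat_numeral)
  moreover have "robbins_form e1 e2 e3 e4 e5 u = 4096 * d\<^sup>2 * g\<^sup>2 *
      (k\<^sup>2 * h\<^sup>2 - g * h ^ 3 - 32 * d * k ^ 3 + 36 * d * g * h * k - 108 * d\<^sup>2 * g\<^sup>2)"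
    unfolding robbins_form_def Let_def t3 t4
    unfolding assms(3,4) h_def[symmetric] k_def[symmetric]
    by (simp add: algebra_simps eval_nat_numeral)
  ultimately show ?thesis
    by simp
qed

text \<open>Weighted homogeneity: with weight \<open>k\<close> for the k-th symmetric function and
  weight 2 for \<open>u\<close>, every term has weight 14. This reduces the circumradius to
  1.\<close>

lemma robbins_scale:
  fixes c :: complex
  shows "robbins (map ((*) c) xs) (c^2 * u) = c ^ 14 * robbins xs u"
proof -
  have t2: "(c * e1)\<^sup>2 + c\<^sup>2 * u - 4 * (c\<^sup>2 * e2) = c\<^sup>2 * (e1\<^sup>2 + u - 4 * e2)" for e1 e2
    by (simp add: algebra_simps power2_eq_square)
  have t3: "c * e1 * (c\<^sup>2 * t2) + 8 * (c ^ 3 * e3) = c ^ 3 * (e1 * t2 + 8 * e3)" for e1 t2 e3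
    by (simp add: algebra_simps eval_nat_numeral)
  have t4: "(c\<^sup>2 * t2)\<^sup>2 - 64 * (c ^ 4 * e4) = c ^ 4 * (t2\<^sup>2 - 64 * e4)" for t2 e4
    by (simp add: algebra_simps eval_nat_numeral)
  have H: "c\<^sup>2 * u * (c ^ 4 * t4) ^ 3 + (c ^ 3 * t3)\<^sup>2 * (c ^ 4 * t4)\<^sup>2
      - 16 * (c ^ 3 * t3) ^ 3 * (128 * (c ^ 5 * e5))
      - 18 * (c\<^sup>2 * u) * (c ^ 3 * t3) * (c ^ 4 * t4) * (128 * (c ^ 5 * e5))
      - 27 * (c\<^sup>2 * u)\<^sup>2 * (128 * (c ^ 5 * e5))\<^sup>2 =
      c ^ 14 * (u * t4 ^ 3 + t3\<^sup>2 * t4\<^sup>2 - 16 * t3 ^ 3 * (128 * e5)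
      - 18 * u * t3 * t4 * (128 * e5) - 27 * u\<^sup>2 * (128 * e5)\<^sup>2)" for t3 t4 e5
    by (simp add: algebra_simps eval_nat_numeral)
  show ?thesis
    unfolding robbins_def robbins_form_def Let_def esym_scale power_one_right t2 t3 t4 H ..
qed

text \<open>The products \<open>T i * S j\<close> also contain terms in which some number meets its
  own reciprocal; the subtracted multiples count these collapsed terms.\<close>

lemma esym_add_recip:
  fixes a b c d e :: complex
  assumes I: "a * a' = 1" "b * b' = 1" "c * c' = 1" "d * d' = 1" "e * e' = 1"
  defines "T \<equiv> \<lambda>k. esym k [a, b, c, d, e]" and "S \<equiv> \<lambda>k. esym k [a', b', c', d', e']"
    and "F \<equiv> \<lambda>k. esym k [a + a', b + b', c + c', d + d', e + e']"
  shows "F 1 = T 1 + S 1"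
    and "F 2 = T 2 + S 2 + T 1 * S 1 - 5"
    and "F 3 = T 3 + S 3 + T 2 * S 1 - 4 * T 1 + T 1 * S 2 - 4 * S 1"
    and "F 4 = T 4 + S 4 + T 3 * S 1 - 3 * T 2 + T 1 * S 3 - 3 * S 2 + T 2 * S 2 - 3 * T 1 * S 1 + 5"
proof -
  have J: "a * (a' * x) = x" "b * (b' * x) = x" "c * (c' * x) = x" "d * (d' * x) = x"
    "e * (e' * x) = x" for x
    using I by (simp_all flip: mult.assoc)
  show "F 1 = T 1 + S 1"
    "F 2 = T 2 + S 2 + T 1 * S 1 - 5"
    "F 3 = T 3 + S 3 + T 2 * S 1 - 4 * T 1 + T 1 * S 2 - 4 * S 1"
    "F 4 = T 4 + S 4 + T 3 * S 1 - 3 * T 2 + T 1 * S 3 - 3 * S 2 + T 2 * S 2 - 3 * T 1 * S 1 + 5"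
    by (simp_all add: F_def T_def S_def eval_nat_numeral algebra_simps I J)
qed

text \<open>As the whole product is 1, the reciprocal of a subproduct is the complementary
  subproduct.\<close>

lemma esym_recip:
  fixes a b c d e :: complex
  assumes I: "a * a' = 1" "b * b' = 1" "c * c' = 1" "d * d' = 1" "e * e' = 1"
    and P: "a * b * c * d * e = 1"
  defines "T \<equiv> \<lambda>k. esym k [a, b, c, d, e]" and "S \<equiv> \<lambda>k. esym k [a', b', c', d', e']"
  shows "S 1 = T 4" "S 2 = T 3" "S 3 = T 2" "S 4 = T 1"
proof -
  have J: "a * (a' * x) = x" "b * (b' * x) = x" "c * (c' * x) = x" "d * (d' * x) = x"
    "e * (e' * x) = x" for x
    using I by (simp_all flip: mult.assoc)
  have K: "S k = (a * b * c * d * e) * S k" for k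
    using P by simp
  show "S 1 = T 4" "S 2 = T 3" "S 3 = T 2" "S 4 = T 1"
    by (subst K, simp add: T_def S_def eval_nat_numeral algebra_simps I J)+
qed

lemma esym_diff_2:
  fixes a b c d e :: complex
  defines "E \<equiv> \<lambda>k. esym k [2 - a, 2 - b, 2 - c, 2 - d, 2 - e]" and "F \<equiv> \<lambda>k. esym k [a, b, c, d, e]"
  shows "E 1 = 10 - F 1"
    and "E 2 = 40 - 8 * F 1 + F 2"
    and "E 3 = 80 - 24 * F 1 + 6 * F 2 - F 3"
    and "E 4 = 80 - 32 * F 1 + 12 * F 2 - 4 * F 3 + F 4"
  by (simp_all add: E_def F_def eval_nat_numeral algebra_simps)

text \<open>
  In terms of the elementary symmetric functions \<open>T\<^sub>k\<close> of the ratios, \<open>F\<^sub>k\<close> are those of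
  \<open>q\<^sub>j + 1 / q\<^sub>j\<close> and the arguments of the form those of \<open>2 - q\<^sub>j - 1 / q\<^sub>j\<close>.
\<close>

lemma robbins_form_recip:
  fixes T1 T2 T3 T4 :: complex
  defines "F1 \<equiv> T1 + T4" and "F2 \<equiv> T2 + T3 + T1 * T4 - 5"
    and "F3 \<equiv> T3 + T2 + T2 * T4 - 4 * T1 + T1 * T3 - 4 * T4"
    and "F4 \<equiv> T4 + T1 + T3 * T4 - 3 * T2 + T1 * T2 - 3 * T3 + T2 * T3 - 3 * T1 * T4 + 5"
  shows "robbins_form (10 - F1) (40 - 8 * F1 + F2) (80 - 24 * F1 + 6 * F2 - F3)
    (80 - 32 * F1 + 12 * F2 - 4 * F3 + F4) (- (T1 - T2 + T3 - T4)\<^sup>2) (- (T1 - T4)\<^sup>2) = 0"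
proof (rule robbins_form_eq_0)
  \<comment> \<open>The quadratic terms cancel, since
    \<open>F1^2 - (T1 - T4)^2 = 4 * T1 * T4\<close>, which is also the quadratic part of
    \<open>4 * F2\<close>.\<close>
  have t2: "(10 - F1)\<^sup>2 + (- (T1 - T4)\<^sup>2) - 4 * (40 - 8 * F1 + F2) =
      12 * (T1 + T4) - 4 * (T2 + T3) - 40"
    by (simp add: F1_def F2_def power2_eq_square algebra_simps)
  show "(10 - F1) * ((10 - F1)\<^sup>2 + (- (T1 - T4)\<^sup>2) - 4 * (40 - 8 * F1 + F2))
      + 8 * (80 - 24 * F1 + 6 * F2 - F3) =
      - 4 * (T1 - T4) * ((T1 - T2 + T3 - T4) + 2 * (T1 - T4))"
    unfolding t2 by (simp add: F1_def F2_def F3_def algebra_simps)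
  show "((10 - F1)\<^sup>2 + (- (T1 - T4)\<^sup>2) - 4 * (40 - 8 * F1 + F2))\<^sup>2
      - 64 * (80 - 32 * F1 + 12 * F2 - 4 * F3 + F4) =
      16 * (T1 - T2 + T3 - T4) * ((T1 - T2 + T3 - T4) + 8 * (T1 - T4))"
    unfolding t2 by (simp add: F1_def F2_def F3_def F4_def power2_eq_square algebra_simps)
qed (rule refl)+

text \<open>Circumradius 1 in algebraic form: for a ratio \<open>q\<close> on the unit circle,
  \<open>2 - (q + 1 / q)\<close> is a squared chord, and the last argument is 16 times the squared
  area.\<close>

lemma robbins_recip:
  fixes a b c d e :: complex
  assumes I: "a * a' = 1" "b * b' = 1" "c * c' = 1" "d * d' = 1" "e * e' = 1"
    and P: "a * b * c * d * e = 1"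
  shows "robbins [2 - (a + a'), 2 - (b + b'), 2 - (c + c'), 2 - (d + d'), 2 - (e + e')]
    (- (a + b + c + d + e - (a' + b' + c' + d' + e'))\<^sup>2) = 0"
proof -
  define T where "T = (\<lambda>k. esym k [a, b, c, d, e])"
  note S = esym_recip[OF I P]
  note E = esym_diff_2[of "a + a'" "b + b'" "c + c'" "d + d'" "e + e'",
      unfolded esym_add_recip[OF I] S]
  have D: "a + b + c + d + e - (a' + b' + c' + d' + e') = T 1 - T 4"
    using S(1) by (simp add: T_def algebra_simps)
  have G: "(1 - a) * (1 - b) * (1 - c) * (1 - d) * (1 - e) = - (T 1 - T 2 + T 3 - T 4)"
    using P by (simp add: T_def eval_nat_numeral algebra_simps)
  \<comment> \<open>The fifth symmetric function thereby becomes minus a perfect square, as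
    \<open>robbins_form_eq_0\<close> demands; its root is given by \<open>G\<close>.\<close>
  have sq: "2 - (x + x') = - ((1 - x)\<^sup>2 * x')" if "x * x' = 1" for x x' :: complex
  proof -
    have "(1 - x)\<^sup>2 * x' = x' - 2 * (x * x') + x * (x * x')"
      by (simp add: power2_eq_square algebra_simps)
    then show ?thesis
      unfolding that by simp
  qed
  have P': "a' * b' * c' * d' * e' = 1"
  proof -
    have "a' * b' * c' * d' * e' = (a * b * c * d * e) * (a' * b' * c' * d' * e')"
      using P by simp
    also have "\<dots> = (a * a') * (b * b') * (c * c') * (d * d') * (e * e')"
      by (simp only: mult_ac)
    finally show ?thesis
      using I by simp
  qed
  have "esym 5 [2 - (a + a'), 2 - (b + b'), 2 - (c + c'), 2 - (d + d'), 2 - (e + e')] =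
      - ((1 - a) * (1 - b) * (1 - c) * (1 - d) * (1 - e))\<^sup>2 * (a' * b' * c' * d' * e')"
    unfolding sq[OF I(1)] sq[OF I(2)] sq[OF I(3)] sq[OF I(4)] sq[OF I(5)]
    by (simp add: eval_nat_numeral)
  then have E5: "esym 5 [2 - (a + a'), 2 - (b + b'), 2 - (c + c'), 2 - (d + d'), 2 - (e + e')] =
      - (T 1 - T 2 + T 3 - T 4)\<^sup>2"
    unfolding G P' power2_minus by simp
  show ?thesis
    unfolding robbins_def E E5 D unfolding T_def
    by (rule robbins_form_recip)
qed

subsection \<open>Geometry of bicentric pentagons\<close>

definition cx :: "real ^ 2 \<Rightarrow> complex" where
  "cx v = Complex (v $ 1) (v $ 2)"

lemma cx_simps:
  "cx (v + w) = cx v + cx w" "cx (v - w) = cx v - cx w" "cx (t *\<^sub>R v) = of_real t * cx v"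
  "norm (cx v) = norm v" "Re (cnj (cx v) * cx w) = v \<bullet> w"
  by (simp_all add: cx_def complex_eq_iff norm_vec_def L2_set_def sum_2 cmod_def
      inner_vec_def)

lemma inj_cx: "inj cx"
proof (rule injI)
  fix v w assume "cx v = cx w"
  then have "v $ 1 = w $ 1" "v $ 2 = w $ 2"
    by (simp_all add: cx_def)
  then show "v = w"
    by (simp add: Finite_Cartesian_Product.vec_eq_iff forall_2)
qed

text \<open>\<open>n\<close> points from the centre to the point of tangency. Rotated by
  \<open>n\<close>, the side lies on the line with real part \<open>r\<close>; \<alpha> and \<beta>
  are both positive if it runs counterclockwise, both negative otherwise.\<close>

lemma tangent_at_inner_point_complex:
  assumes "tangent_at_inner_point c r A B" "r > 0"
  obtains n \<alpha> \<beta> where "norm n = 1" "cx A - cx c = n * Complex r (- \<alpha>)"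
    "cx B - cx c = n * Complex r \<beta>" "\<alpha> * \<beta> > 0" "\<bar>\<alpha> + \<beta>\<bar> = dist A B"
proof -
  obtain T where T: "T \<in> open_segment A B" and T_unique: "affine hull {A, B} \<inter> sphere c r = {T}"
    using assms(1) unfolding tangent_at_inner_point_def by blast
  obtain t where t: "0 < t" "t < 1" and T_eq: "T = (1 - t) *\<^sub>R A + t *\<^sub>R B" and "A \<noteq> B"
    using T by (auto simp: in_segment)
  define d where "d = B - A"
  \<comment> \<open>\<open>T - k *\<^sub>R d\<close> is the reflection of \<open>T\<close> in the
    foot of the perpendicular from \<open>c\<close>: it lies on line and circle, so tangency forces
    \<open>k = 0\<close>.\<close>
  define k where "k = 2 * ((T - c) \<bullet> d) / (d \<bullet> d)"
  have d: "d \<bullet> d > 0"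
    using \<open>A \<noteq> B\<close> by (simp add: d_def)
  have T_norm: "norm (T - c) = r"
    using T_unique by (auto simp: dist_norm norm_minus_commute)
  have "T - k *\<^sub>R d = (1 - (t - k)) *\<^sub>R A + (t - k) *\<^sub>R B"
    by (simp add: T_eq d_def algebra_simps)
  then have "T - k *\<^sub>R d \<in> affine hull {A, B}"
    unfolding affine_hull_2 by force
  moreover have "(norm (T - k *\<^sub>R d - c))\<^sup>2 = (norm (T - c))\<^sup>2 + k * (k * (d \<bullet> d) - 2 * ((T - c) \<bullet> d))"
    unfolding power2_norm_eq_inner by (simp add: algebra_simps inner_commute)
  then have "T - k *\<^sub>R d \<in> sphere c r"
    using d assms(2) T_norm by (simp add: k_def dist_norm norm_minus_commute)
  ultimately have "T - k *\<^sub>R d = T"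
    using T_unique by blast
  then have orth: "(T - c) \<bullet> d = 0"
    using d by (auto simp: k_def)
  define w where "w = cx (T - c)"
  \<comment> \<open>By orthogonality \<open>cx d\<close> is a real multiple of
    \<open>\<i> * n\<close>; \<open>l\<close> is that factor, the signed side length.\<close>
  define l where "l = Im (cnj w * cx d) / r"
  define n where "n = w / of_real r"
  have norm_w: "norm w = r"
    unfolding w_def cx_simps(4) by (rule T_norm)
  have "Re (cnj w * cx d) = 0"
    using orth unfolding w_def cx_simps(5) .
  then have "cnj w * cx d = \<i> * of_real (r * l)"
    using assms(2) by (simp add: complex_eq_iff l_def)
  moreover have w: "w * cnj w = of_real (r\<^sup>2)"
    using norm_w by (metis complex_norm_square)
  ultimately have "of_real (r\<^sup>2) * cx d = w * (\<i> * of_real (r * l))"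
    by (simp only: mult.assoc flip: w)
  then have d_eq: "cx d = n * (\<i> * of_real l)"
    using assms(2) by (simp add: n_def field_simps power2_eq_square)
  have w_eq: "w = n * of_real r"
    using assms(2) by (simp add: n_def)
  have "norm n = 1"
    using norm_w assms(2) by (simp add: n_def norm_divide)
  moreover have "cx A - cx c = n * Complex r (- (t * l))"
  proof -
    have "A - c = (T - c) - t *\<^sub>R d"
      by (simp add: T_eq d_def algebra_simps)
    then have "cx A - cx c = w - of_real t * cx d"
      unfolding w_def by (simp only: flip: cx_simps(1-3))
    then show ?thesis
      unfolding d_eq by (simp add: w_eq Complex_eq algebra_simps)
  qed
  moreover have "cx B - cx c = n * Complex r ((1 - t) * l)"
  proof -
    have "B - c = (T - c) + (1 - t) *\<^sub>R d"
      by (simp add: T_eq d_def algebra_simps)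
    then have "cx B - cx c = w + of_real (1 - t) * cx d"
      unfolding w_def by (simp only: flip: cx_simps(1-3))
    then show ?thesis
      unfolding d_eq by (simp add: w_eq Complex_eq algebra_simps)
  qed
  moreover have l: "\<bar>l\<bar> = dist A B"
  proof -
    have "norm (cx d) = \<bar>l\<bar>"
      unfolding d_eq using \<open>norm n = 1\<close> by (simp add: norm_mult)
    then show ?thesis
      unfolding cx_simps(4) by (simp add: d_def dist_norm norm_minus_commute)
  qed
  moreover have "t * l * ((1 - t) * l) > 0"
  proof -
    have "l \<noteq> 0"
      using l \<open>A \<noteq> B\<close> by auto
    moreover have "t * l * ((1 - t) * l) = t * (1 - t) * l\<^sup>2"
      by (simp add: power2_eq_square)
    ultimately show ?thesis
      using t by (simp only:) simp
  qed
  moreover have "t * l + (1 - t) * l = l"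
    by (simp add: algebra_simps)
  ultimately show ?thesis
    by (intro that[of n "t * l" "(1 - t) * l"]) simp_all
qed

text \<open>Along the line, the squared distance to \<open>C\<close> is a quadratic in the parameter
  with leading coefficient \<open>(norm n)^2\<close>, so it takes no value three times.\<close>

lemma line_meets_circle_at_most_twice:
  fixes n C :: complex
  assumes "n \<noteq> 0" "s1 \<noteq> s2" "s1 \<noteq> s3" "s2 \<noteq> s3"
    and N: "norm (n * Complex r s1 - C) = \<rho>" "norm (n * Complex r s2 - C) = \<rho>"
      "norm (n * Complex r s3 - C) = \<rho>"
  shows False
proof -
  define a where "a = (norm n)\<^sup>2"
  define m where "m = n * of_real r - C"
  define b where "b = 2 * Re (cnj m * (\<i> * n))"
  have norm_eq: "(norm (n * Complex r s - C))\<^sup>2 = (norm m)\<^sup>2 + s * b + s\<^sup>2 * a" for s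
    unfolding a_def b_def m_def cmod_power2 by (simp add: algebra_simps power2_eq_square)
  have "(s1 - s2) * (b + (s1 + s2) * a) = 0" "(s1 - s3) * (b + (s1 + s3) * a) = 0"
    using norm_eq[of s1] norm_eq[of s2] norm_eq[of s3] unfolding N
    by (simp_all add: algebra_simps power2_eq_square)
  then have "b + (s1 + s2) * a = 0" "b + (s1 + s3) * a = 0"
    using assms(2,3) by simp_all
  moreover have "(s2 - s3) * a = (b + (s1 + s2) * a) - (b + (s1 + s3) * a)"
    by (simp add: algebra_simps)
  ultimately have "(s2 - s3) * a = 0"
    by simp
  then show False
    using assms by (simp add: a_def)
qed

text \<open>
  The two tangent lengths at a common vertex can only differ in sign if both sides touch the
  incircle at the same point; then three vertices are collinear and cannot lie on a circle.
\<close>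

lemma bicentric_configuration:
  assumes "V \<in> linkage_configurations a" "bicentric V"
  obtains v :: "5 \<Rightarrow> complex" and n X C Q r \<rho> where
    "r > 0" "\<rho> > 0" "\<And>j. norm (v j - C) = \<rho>" "\<And>j. norm (v (j + 1) - v j) = a j"
    "\<And>j. norm (n j) = 1"
    "\<And>j. v j - Q = n j * Complex r (- X j)" "\<And>j. v (j + 1) - Q = n j * Complex r (X (j + 1))"
    "\<And>j. X j * X (j + 1) > 0" "\<And>j. \<bar>X j + X (j + 1)\<bar> = a j"
proof -
  have inj: "inj V" and a: "dist (V j) (V (j + 1)) = a j" for j
    using assms(1) by (auto simp: linkage_configurations_def pentagon_def)
  obtain C' \<rho> where \<rho>: "\<rho> > 0" and C': "V j \<in> sphere C' \<rho>" for j
    using assms(2) unfolding bicentric_def chordal_def by blast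
  obtain Q' r where r: "r > 0" and tang: "tangent_at_inner_point Q' r (V j) (V (j + 1))" for j
    using assms(2) unfolding bicentric_def tangential_def by blast
  define v where "v j = cx (V j)" for j
  define Q where "Q = cx Q'"
  define C where "C = cx C'"
  have inj_v: "v i = v j \<longleftrightarrow> i = j" for i j
    using inj inj_cx by (auto simp: v_def inj_def)
  have "\<exists>n \<alpha> \<beta>. norm n = 1 \<and> v j - Q = n * Complex r (- \<alpha>) \<and> v (j + 1) - Q = n * Complex r \<beta>
      \<and> \<alpha> * \<beta> > 0 \<and> \<bar>\<alpha> + \<beta>\<bar> = a j" for j
    using tangent_at_inner_point_complex[OF tang[of j] r] a[of j] unfolding v_def Q_def by metis
  then obtain n \<alpha> \<beta> where n: "norm (n j) = 1" and A: "v j - Q = n j * Complex r (- \<alpha> j)"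
    and B: "v (j + 1) - Q = n j * Complex r (\<beta> j)" and pos: "\<alpha> j * \<beta> j > 0"
    and sum: "\<bar>\<alpha> j + \<beta> j\<bar> = a j" for j
    by metis
  have C: "norm (v j - C) = \<rho>" for j
    using C'[of j] cx_simps(4)[of "V j - C'"]
    by (simp add: v_def C_def cx_simps dist_norm norm_minus_commute)
  have sides: "norm (v (j + 1) - v j) = a j" for j
    using a[of j] cx_simps(4)[of "V (j + 1) - V j"]
    by (simp add: v_def cx_simps dist_norm norm_minus_commute)
  have \<beta>: "\<beta> j = \<alpha> (j + 1)" for j
  proof (rule ccontr)
    assume neq: "\<beta> j \<noteq> \<alpha> (j + 1)"
    have eq: "n j * Complex r (\<beta> j) = n (j + 1) * Complex r (- \<alpha> (j + 1))"
      using A[of "j + 1"] B[of j] by simp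
    then have "cmod (Complex r (\<beta> j)) = cmod (Complex r (- \<alpha> (j + 1)))"
      using n by (metis mult_1 norm_mult)
    then have "(\<beta> j)\<^sup>2 = (\<alpha> (j + 1))\<^sup>2"
      by (simp add: cmod_def)
    then have opp: "\<beta> j = - \<alpha> (j + 1)"
      using neq by (simp add: power2_eq_iff)
    moreover have "Complex r (\<beta> j) \<noteq> 0"
      using r by (simp add: complex_eq_iff)
    ultimately have n_eq: "n (j + 1) = n j"
      using eq by simp
    let ?L = "\<lambda>s. n j * Complex r s"
    have L: "?L (- \<alpha> j) = v j - Q" "?L (\<beta> j) = v (j + 1) - Q"
      "?L (\<beta> (j + 1)) = v (j + 2) - Q"
      using A[of j] B[of j] B[of "j + 1"] n_eq by (simp_all add: add.assoc)
    \<comment> \<open>Injectivity of the pentagon enters here: it excludes a side folded back onto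
      its neighbour.\<close>
    have "v j \<noteq> v (j + 1)" "v j \<noteq> v (j + 2)" "v (j + 1) \<noteq> v (j + 2)"
      unfolding inj_v by simp_all
    moreover have "s \<noteq> t" if "?L s = y - Q" "?L t = z - Q" "y \<noteq> z" for s t y z
      using that by auto
    ultimately have "- \<alpha> j \<noteq> \<beta> j" "- \<alpha> j \<noteq> \<beta> (j + 1)" "\<beta> j \<noteq> \<beta> (j + 1)"
      using L by blast+
    moreover have "n j \<noteq> 0"
      using n[of j] by auto
    moreover have "norm (?L (- \<alpha> j) - (C - Q)) = \<rho>" "norm (?L (\<beta> j) - (C - Q)) = \<rho>"
      "norm (?L (\<beta> (j + 1)) - (C - Q)) = \<rho>"
      unfolding L using C by (simp_all add: algebra_simps)
    ultimately show False
      using line_meets_circle_at_most_twice by blast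
  qed
  show ?thesis
    using that[of r \<rho> v C n Q \<alpha>] r \<rho> C sides n A B pos sum unfolding \<beta> by blast
qed

section \<open>Signed area, and closing up around the two centres\<close>

lemma sum_5: "(\<Sum>j\<in>UNIV. f j) = f 0 + f 1 + f 2 + f 3 + f (4 :: 5)"
  unfolding UNIV_5 by (simp add: add.assoc)

lemma prod_5: "(\<Prod>j\<in>UNIV. f j) = f 0 * f 1 * f 2 * f 3 * f (4 :: 5)"
  unfolding UNIV_5 by (simp add: mult.assoc)

lemma bij_add_right: "bij (\<lambda>j. j + k :: 'b::group_add)"
  by (rule bij_betw_byWitness[where f' = "\<lambda>j. j - k"]) auto

text \<open>Twice the signed area does not depend on the origin: after the index shift the two terms
  linear in \<open>c\<close> are conjugate, so only real parts change.\<close>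

lemma sum_cross_translate:
  fixes v :: "5 \<Rightarrow> complex"
  shows "(\<Sum>j\<in>UNIV. Im (cnj (v j - c) * (v (j + 1) - c))) = (\<Sum>j\<in>UNIV. Im (cnj (v j) * v (j + 1)))"
proof -
  have shift: "(\<Sum>j\<in>UNIV. v (j + 1)) = (\<Sum>j\<in>UNIV. v j)"
    using sum.reindex_bij_betw[OF bij_add_right] .
  have "(\<Sum>j\<in>UNIV. cnj (v j - c) * (v (j + 1) - c)) = (\<Sum>j\<in>UNIV. cnj (v j) * v (j + 1))
      - cnj c * (\<Sum>j\<in>UNIV. v (j + 1)) - cnj (\<Sum>j\<in>UNIV. v j) * c + 5 * (cnj c * c)"
    by (simp add: algebra_simps sum.distrib sum_subtractf sum_distrib_left sum_distrib_right)
  then have "Im (\<Sum>j\<in>UNIV. cnj (v j - c) * (v (j + 1) - c)) = Im (\<Sum>j\<in>UNIV. cnj (v j) * v (j + 1))"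
    unfolding shift by (simp add: sum_negf)
  then show ?thesis
    by (simp only: Im_sum)
qed

text \<open>The sum is twice the signed area, so the second argument of \<open>robbins\<close> is 16
  times its square.\<close>

lemma robbins_chordal:
  fixes v :: "5 \<Rightarrow> complex"
  assumes \<rho>: "\<rho> > 0" "\<And>j. norm (v j - C) = \<rho>"
  shows "robbins (map (\<lambda>j. (norm (v (j + 1) - v j))\<^sup>2) [0, 1, 2, 3, 4])
    (4 * (\<Sum>j\<in>UNIV. Im (cnj (v j) * v (j + 1)))\<^sup>2) = 0"
proof -
  define w where "w j = v j - C" for j
  define q where "q j = w (j + 1) / w j" for j
  define q' where "q' j = w j / w (j + 1)" for j
  define b where "b j = (norm (v (j + 1) - v j))\<^sup>2" for j
  define D where "D = (\<Sum>j\<in>UNIV. q j) - (\<Sum>j\<in>UNIV. q' j)"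
  define Z where "Z = (\<Sum>j\<in>UNIV. Im (cnj (v j) * v (j + 1)))"
  define c where "c = complex_of_real (\<rho>\<^sup>2)"
  have w0: "w j \<noteq> 0" for j
    using \<rho>(1) \<rho>(2)[of j] by (auto simp: w_def)
  have ww: "w j * cnj (w j) = c" for j
    unfolding c_def \<rho>(2)[of j, symmetric] w_def by (rule complex_norm_square[symmetric])
  have "c \<noteq> 0"
    using \<rho>(1) by (simp add: c_def)
  have qq': "q j * q' j = 1" for j
    using w0 by (simp add: q_def q'_def)
  have prod_q: "q 0 * q 1 * q 2 * q 3 * q 4 = 1"
  proof -
    have five: "(5 :: 5) = 0" by simp
    show ?thesis
      using w0 by (simp add: q_def five)
  qed
  \<comment> \<open>On the circle \<open>1 / w j = cnj (w j) / c\<close>, so \<open>q j\<close> and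
    \<open>q' j\<close> are conjugate, and \<open>c * D\<close> is \<open>2 * \<i>\<close> times the
    sum taken from the circumcentre.\<close>
  have q: "c * q j = cnj (w j) * w (j + 1)" for j
    using w0[of j] ww[of j] by (simp add: q_def field_simps)
  have q': "c * q' j = w j * cnj (w (j + 1))" for j
    using w0[of "j + 1"] ww[of "j + 1"] by (simp add: q'_def field_simps)
  have b: "complex_of_real (b j) = c * (2 - (q j + q' j))" for j
  proof -
    have "complex_of_real (b j) = (w (j + 1) - w j) * cnj (w (j + 1) - w j)"
      unfolding b_def w_def complex_norm_square by simp
    also have "\<dots> = c * 2 - (c * q j + c * q' j)"
      unfolding q q' using ww[of j] ww[of "j + 1"] by (simp add: algebra_simps)
    finally show ?thesis
      by (simp add: algebra_simps)
  qed
  have "c * D = (\<Sum>j\<in>UNIV. cnj (w j) * w (j + 1) - w j * cnj (w (j + 1)))"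
    by (simp add: D_def right_diff_distrib sum_distrib_left sum_subtractf q q')
  also have "\<dots> = (\<Sum>j\<in>UNIV. 2 * \<i> * of_real (Im (cnj (w j) * w (j + 1))))"
    by (intro sum.cong) (auto simp: complex_eq_iff)
  also have "\<dots> = 2 * \<i> * of_real Z"
    unfolding Z_def w_def sum_distrib_left[symmetric] of_real_sum[symmetric] sum_cross_translate ..
  finally have cD: "c * D = 2 * \<i> * of_real Z" .
  have "c\<^sup>2 * (- D\<^sup>2) = - (c * D)\<^sup>2"
    by (simp add: power_mult_distrib)
  also have "\<dots> = of_real (4 * Z\<^sup>2)"
    unfolding cD by (simp add: power_mult_distrib)
  finally have D: "c\<^sup>2 * (- D\<^sup>2) = of_real (4 * Z\<^sup>2)" .
  have "complex_of_real (robbins (map b [0, 1, 2, 3, 4]) (4 * Z\<^sup>2)) =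
      robbins (map ((*) c) (map (\<lambda>j. 2 - (q j + q' j)) [0, 1, 2, 3, 4])) (c\<^sup>2 * (- D\<^sup>2))"
    unfolding D robbins_of_real[symmetric] by (simp add: b)
  also have "\<dots> = 0"
    unfolding robbins_scale D_def sum_5
    using robbins_recip[OF qq' qq' qq' qq' qq' prod_q] by simp
  finally show ?thesis
    unfolding b_def Z_def by simp
qed

text \<open>Each vertex is described from both of its sides. Multiplying all vertices in both ways
  and cancelling the factors \<open>n j\<close> shows that \<open>P\<close> is real.\<close>

lemma sylvester_root:
  fixes X :: "5 \<Rightarrow> real"
  assumes "r > 0"
    and A: "\<And>j. A j = n j * Complex r (- X j)" "\<And>j. A (j + 1) = n j * Complex r (X (j + 1))"
    and n: "\<And>j. norm (n j) = 1"
  shows "elem_sym 1 X * r ^ 4 - elem_sym 3 X * r ^ 2 + elem_sym 5 X = 0"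
proof -
  define P where "P = (\<Prod>j\<in>UNIV. Complex r (X j))"
  have "(\<Prod>j\<in>UNIV. A j) = (\<Prod>j\<in>UNIV. n j) * (\<Prod>j\<in>UNIV. cnj (Complex r (X j)))"
    unfolding A(1) prod.distrib complex_cnj ..
  moreover have "(\<Prod>j\<in>UNIV. A j) = (\<Prod>j\<in>UNIV. A (j + 1))"
    using prod.reindex_bij_betw[OF bij_add_right] by metis
  moreover have "\<dots> = (\<Prod>j\<in>UNIV. n j) * (\<Prod>j\<in>UNIV. Complex r (X (j + 1)))"
    unfolding A(2) prod.distrib ..
  moreover have "(\<Prod>j\<in>UNIV. Complex r (X (j + 1))) = P"
    unfolding P_def using prod.reindex_bij_betw[OF bij_add_right, of "\<lambda>j. Complex r (X j)"] .
  moreover have "(\<Prod>j\<in>UNIV. n j) \<noteq> 0"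
    using n by (metis finite norm_zero prod_zero_iff zero_neq_one)
  ultimately have "cnj P = P"
    by (simp add: P_def)
  then have "Im P = 0"
    by (simp add: complex_eq_iff)
  moreover have "Im P = elem_sym 1 X * r ^ 4 - elem_sym 3 X * r ^ 2 + elem_sym 5 X"
    unfolding P_def prod_5 elem_sym_5 by (simp add: eval_nat_numeral algebra_simps)
  ultimately show ?thesis by simp
qed

section \<open>The common root of the two polynomials\<close>

theorem theorem1:
  fixes a :: "5 \<Rightarrow> real"
  assumes "\<forall>j. a j > 0"
    and "\<exists>V \<in> linkage_configurations a. bicentric V"
  shows "resultant (modified_sylvester_poly a) (robbins_poly a) = 0"
proof -
  obtain V where "V \<in> linkage_configurations a" "bicentric V"
    using assms(2) by blast
  then obtain v :: "5 \<Rightarrow> complex" and n X C Q r \<rho> where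
    r: "r > 0" and \<rho>: "\<rho> > 0" "\<And>j. norm (v j - C) = \<rho>" and sides: "\<And>j. norm (v (j + 1) - v j) = a j"
    and n: "\<And>j. norm (n j) = 1"
    and v: "\<And>j. v j - Q = n j * Complex r (- X j)" "\<And>j. v (j + 1) - Q = n j * Complex r (X (j + 1))"
    and pos: "\<And>j. X j * X (j + 1) > 0" and X: "\<And>j. \<bar>X j + X (j + 1)\<bar> = a j"
    by (rule bicentric_configuration) blast
  \<comment> \<open>The orientation around the incentre. All \<open>X j\<close> share this sign, so
    their absolute values solve the linear system.\<close>
  define \<epsilon> where "\<epsilon> = sgn (X 0)"
  have sgn_step: "sgn (X (j + 1)) = sgn (X j)" for j
    using pos[of j] by (auto simp: zero_less_mult_iff)
  have sgn_X: "sgn (X j) = \<epsilon>" for j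
  proof -
    have "j \<in> {0, 1, 2, 3, 4}"
      using UNIV_5 by blast
    then show ?thesis
      using sgn_step[of 0] sgn_step[of 1] sgn_step[of 2] sgn_step[of 3] by (auto simp: \<epsilon>_def)
  qed
  have "X 0 \<noteq> 0"
    using pos[of 0] by auto
  then have \<epsilon>: "\<epsilon> * \<epsilon> = 1"
    by (auto simp: \<epsilon>_def sgn_if)
  define x where "x j = \<epsilon> * X j" for j
  have x_abs: "x j = \<bar>X j\<bar>" for j
    unfolding x_def sgn_X[of j, symmetric] by (simp add: abs_sgn mult.commute)
  have X_x: "X j = \<epsilon> * x j" for j
    unfolding x_def using \<epsilon> by (simp flip: mult.assoc)
  have x_sum: "x j + x (j + 1) = a j" for j
    unfolding X[symmetric] x_abs using pos[of j] by (auto simp: zero_less_mult_iff)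
  have tangent: "tangent_lengths a = x"
    unfolding tangent_lengths_def
    by (rule the1_equality[OF tangent_lengths_unique_solution]) (simp add: x_sum)
  define p where "p = semiperimeter a"
  define u where "u = 16 * r\<^sup>2 * p\<^sup>2"
  \<comment> \<open>Twice the signed area of the triangle over side \<open>j\<close> with apex at
    the incentre; the sum yields \<open>\<epsilon> * r * p\<close> as signed area.\<close>
  have cross: "Im (cnj (v j - Q) * (v (j + 1) - Q)) = \<epsilon> * r * a j" for j
  proof -
    have "cnj (v j - Q) * (v (j + 1) - Q) = (cnj (n j) * n j) * (Complex r (X j) * Complex r (X (j + 1)))"
      unfolding v(1)[of j] v(2)[of j] by (simp add: complex_cnj mult_ac)
    also have "cnj (n j) * n j = 1"
      using n[of j] by (metis complex_norm_square mult.commute of_real_1 power_one)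
    finally show ?thesis
      by (simp add: X_x x_sum[symmetric] algebra_simps)
  qed
  have "(\<Sum>j\<in>UNIV. Im (cnj (v j) * v (j + 1))) = \<epsilon> * r * (2 * p)"
    unfolding sum_cross_translate[of v Q, symmetric] cross p_def semiperimeter_def
    by (simp flip: sum_distrib_left)
  then have u: "4 * (\<Sum>j\<in>UNIV. Im (cnj (v j) * v (j + 1)))\<^sup>2 = u"
    using \<epsilon> by (simp add: u_def power_mult_distrib power2_eq_square[of \<epsilon>])
  have robbins: "poly (robbins_poly a) u = 0"
    using robbins_chordal[of \<rho> v C, OF \<rho>] unfolding poly_robbins_poly sides u .
  have "elem_sym 1 X * r ^ 4 - elem_sym 3 X * r ^ 2 + elem_sym 5 X = 0"
    by (rule sylvester_root[of r "\<lambda>j. v j - Q" n X, OF r v n])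
  \<comment> \<open>Only odd degrees occur, so the sign factors out of the whole equation.\<close>
  moreover have "elem_sym 1 X = \<epsilon> * elem_sym 1 x" "elem_sym 3 X = \<epsilon> * elem_sym 3 x"
    "elem_sym 5 X = \<epsilon> * elem_sym 5 x"
  proof -
    have "elem_sym k X = \<epsilon> ^ k * elem_sym k x" for k
      unfolding elem_sym_5 esym_scale[symmetric] by (simp add: X_x)
    then show "elem_sym 1 X = \<epsilon> * elem_sym 1 x" "elem_sym 3 X = \<epsilon> * elem_sym 3 x"
      "elem_sym 5 X = \<epsilon> * elem_sym 5 x"
      using \<epsilon> by (simp_all add: eval_nat_numeral)
  qed
  ultimately have "\<epsilon> * (elem_sym 1 x * r ^ 4 - elem_sym 3 x * r ^ 2 + elem_sym 5 x) = 0"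
    by (simp add: algebra_simps)
  then have root: "elem_sym 1 x * r ^ 4 - elem_sym 3 x * r ^ 2 + elem_sym 5 x = 0"
    using \<epsilon> by auto
  have "poly (modified_sylvester_poly a) u =
      256 * p ^ 4 * (elem_sym 1 x * r ^ 4 - elem_sym 3 x * r ^ 2 + elem_sym 5 x)"
    unfolding modified_sylvester_poly_def Let_def tangent p_def[symmetric] u_def
    by (simp add: eval_nat_numeral algebra_simps)
  then have sylvester: "poly (modified_sylvester_poly a) u = 0"
    unfolding root by simp
  \<comment> \<open>The leading coefficient is nonzero, so the gcd criterion applies.\<close>
  have "elem_sym 1 x > 0"
    unfolding elem_sym_5 x_abs using \<open>X 0 \<noteq> 0\<close> by simp
  then have "modified_sylvester_poly a \<noteq> 0"
    unfolding modified_sylvester_poly_def Let_def tangent by simp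
  then show ?thesis
    using sylvester robbins by (rule resultant_eq_0_if_common_root)
qed

end
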